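(* Let $(R,\alpha,\beta)$ be a regular BiHom-Lie conformal algebra and let $f\in\widetilde C^1_{\alpha,\beta}(R,R_{-1})$ be a Nijenhuis operator. Then a deformation of $(R,\alpha,\beta)$ is obtained by putting $$\psi_{\lambda,-\partial-\lambda}(a,b)=[a_\lambda b]_N:=[f(a)_\lambda b]+[a_\lambda f(b)]-f([a_\lambda b]),\qquad a,b\in R;$$ that is, the brackets $[a_\lambda b]_t=[a_\lambda b]+t\,\psi_{\lambda,-\partial-\lambda}(a,b)$ make $(R,[\cdot_\lambda\cdot]_t,\alpha,\beta)$ a BiHom-Lie conformal algebra for every value of the parameter $t$. Furthermore, this deformation is trivial.
   Context: All vector spaces are over $\mathbb{C}$; for a vector space $V$, $V[\lambda]=\mathbb{C}[\lambda]\otimes V$. The parameter $t$ ranges over $\mathbb{C}$. A BiHom-Lie conformal algebra $(R,\alpha,\beta)$ is a $\mathbb{C}[\partial]$-module $R$ with two commuting linear maps $\alpha,\beta:R\to R$ such that $\alpha\partial=\partial\alpha$, $\beta\partial=\partial\beta$, $\alpha([a_\lambda b])=[\alpha(a)_\lambda\alpha(b)]$, $\beta([a_\lambda b])=[\beta(a)_\lambda\beta(b)]$, and a $\mathbb{C}$-bilinear $\lambda$-bracket $[\cdot_\lambda\cdot]:R\otimes R\to R[\lambda]$ such that for all $a,b,c\in R$: (i) $[\partial a_\lambda b]=-\lambda[a_\lambda b]$ and $[a_\lambda\partial b]=(\partial+\lambda)[a_\lambda b]$; (ii) $[\beta(a)_\lambda\alpha(b)]=-[\beta(b)_{-\lambda-\partial}\alpha(a)]$;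 (iii) $[\alpha\beta(a)_\lambda[b_\mu c]]=[[\beta(a)_\lambda b]_{\lambda+\mu}\beta(c)]+[\beta(b)_\mu[\alpha(a)_\lambda c]]$. Here, if $[x_\lambda y]=\sum_j\lambda^j w_j$, then $[x_{-\lambda-\partial}y]=\sum_j(-\lambda-\partial)^j w_j$. The algebra is regular if moreover $\alpha,\beta$ are algebra isomorphisms (bijective). An element of $\widetilde C^1_{\alpha,\beta}(R,R_{-1})$ is a $1$-cochain of $R$ with values in $R$: a $\mathbb{C}$-linear map $a\mapsto\gamma_\lambda(a)$, $R\to R[\lambda]$, with $\gamma_\lambda(\partial a)=-\lambda\gamma_\lambda(a)$, $\gamma_\lambda(\alpha(a))=\alpha(\gamma_\lambda(a))$, $\gamma_\lambda(\beta(a))=\beta(\gamma_\lambda(a))$. (The subscript $-1$ refers to the action $a_\lambda b=[\alpha^{-1}(a)_\lambda b]$ of $R$ on itself, which does not enter these conditions.) Such a cochain is regarded as the linear operator $f:R\to R$, $f(a)=\gamma_{-\partial}(a)$ (if $\gamma_\lambda(a)=\sum_j\lambda^jw_j$, then $f(a)=\sum_j(-\partial)^jw_j$); thus $f$ is $\mathbb{C}[\partial]$-linear and commutes with $\alpha$ and $\beta$. Operators are extended to $R[\lambda]$ coefficientwise. $f$ is a Nijenhuis operator if $[f(a)_\lambda f(b)]=f([a_\lambda b]_N)$ for all $a,b\in R$, where $[a_\lambda b]_N=[f(a)_\lambda b]+[a_\lambda f(b)]-f([a_\lambda b])$. A bilinear operation $\psi_{\lambda,-\partial-\lambda}:R\otimes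 R\to R[\lambda]$ commuting with $\alpha$ and $\beta$ generates a deformation of $R$ if $[a_\lambda b]_t=[a_\lambda b]+t\psi_{\lambda,-\partial-\lambda}(a,b)$ endows $(R,\alpha,\beta)$ with a BiHom-Lie conformal algebra structure. The deformation is trivial if there is a linear operator $g\in\widetilde C^1_{\alpha,\beta}(R,R_{-1})$ such that, with $T_t=\mathrm{id}+tg$, $T_t([a_\lambda b]_t)=[T_t(a)_\lambda T_t(b)]$ for all $a,b\in R$. *)

theory Defs
  imports Complex_Main "HOL-Computational_Algebra.Polynomial"
begin

text \<open>
  A \<open>\<complex>[\<partial>]\<close>-module is given as a complex vector space (scalar multiplication \<open>scale\<close>)
  on a type \<open>'a\<close> together with a linear endomorphism \<open>d\<close>, the action of \<open>\<partial>\<close>.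
  \<open>R[\<lambda>]\<close> is \<open>'a poly\<close>: there, \<open>pCons 0\<close> is multiplication by \<open>\<lambda>\<close> and \<open>map_poly h\<close> is the
  coefficientwise extension of \<open>h\<close>. A \<open>\<lambda>\<close>-bracket \<open>[a\<^sub>\<lambda>b]\<close> is \<open>br a b :: 'a poly\<close>.
\<close>

text \<open>
  For \<open>p = \<Sum>\<^sub>j x\<^sup>j w\<^sub>j\<close>, \<open>subst_poly e X p\<close> is \<open>\<Sum>\<^sub>j X\<^sup>j (e w\<^sub>j)\<close>: the variable is replaced by the
  operator \<open>X\<close> on \<open>'m\<close>, after the coefficients have been mapped into \<open>'m\<close> by \<open>e\<close>.
\<close>

definition subst_poly ::
    "('a::zero \<Rightarrow> 'm::comm_monoid_add) \<Rightarrow> ('m \<Rightarrow> 'm) \<Rightarrow> 'a poly \<Rightarrow> 'm" where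
  "subst_poly e X p = (\<Sum>j\<le>degree p. (X ^^ j) (e (coeff p j)))"

text \<open>
  \<open>R[\<lambda>, \<mu>]\<close> is \<open>'a poly poly\<close>, with \<open>\<lambda>\<close> the inner and \<open>\<mu>\<close> the outer variable.
\<close>

definition mult_lambda :: "'a::zero poly poly \<Rightarrow> 'a poly poly" where
  "mult_lambda = map_poly (pCons 0)"

definition mult_mu :: "'a::zero poly poly \<Rightarrow> 'a poly poly" where
  "mult_mu = pCons 0"

definition mult_lambda_mu :: "'a::ab_group_add poly poly \<Rightarrow> 'a poly poly" where
  "mult_lambda_mu q = mult_lambda q + mult_mu q"

text \<open>\<open>br_at br X u v\<close> is the element \<open>[u\<^sub>X v]\<close> of \<open>R[\<lambda>, \<mu>]\<close>, for \<open>X\<close> one of \<open>\<lambda>\<close>, \<open>\<mu>\<close>, \<open>\<lambda> + \<mu>\<close>.\<close>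

definition br_at :: "('a::ab_group_add \<Rightarrow> 'a \<Rightarrow> 'a poly) \<Rightarrow> ('a poly poly \<Rightarrow> 'a poly poly)
    \<Rightarrow> 'a \<Rightarrow> 'a \<Rightarrow> 'a poly poly" where
  "br_at br X u v = subst_poly (\<lambda>w. [:[:w:]:]) X (br u v)"

text \<open>Given \<open>[x\<^sub>\<lambda>y] = p\<close>, this is \<open>[x\<^bsub>-\<lambda>-\<partial>\<^esub>y]\<close>.\<close>

definition subst_skew :: "('a::ab_group_add \<Rightarrow> 'a) \<Rightarrow> 'a poly \<Rightarrow> 'a poly" where
  "subst_skew d p = subst_poly (\<lambda>w. [:w:]) (\<lambda>q. - pCons 0 q - map_poly d q) p"

definition bilinear_op :: "(complex \<Rightarrow> 'a::ab_group_add \<Rightarrow> 'a) \<Rightarrow> ('a \<Rightarrow> 'a \<Rightarrow> 'a poly) \<Rightarrow> bool" where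
  "bilinear_op scale br \<longleftrightarrow>
     (\<forall>b. Vector_Spaces.linear scale (\<lambda>c. map_poly (scale c)) (\<lambda>a. br a b)) \<and>
     (\<forall>a. Vector_Spaces.linear scale (\<lambda>c. map_poly (scale c)) (\<lambda>b. br a b))"

definition commutes_with_op :: "('a::zero \<Rightarrow> 'a) \<Rightarrow> ('a \<Rightarrow> 'a \<Rightarrow> 'a poly) \<Rightarrow> bool" where
  "commutes_with_op h br \<longleftrightarrow> (\<forall>a b. map_poly h (br a b) = br (h a) (h b))"

locale bihom_lie_conformal_algebra = vector_space scale
  for scale :: "complex \<Rightarrow> 'a::ab_group_add \<Rightarrow> 'a" +
  fixes d \<alpha> \<beta> :: "'a \<Rightarrow> 'a"
    and br :: "'a \<Rightarrow> 'a \<Rightarrow> 'a poly"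
  assumes linear_d: "Vector_Spaces.linear scale scale d"
    and linear_alpha: "Vector_Spaces.linear scale scale \<alpha>"
    and linear_beta: "Vector_Spaces.linear scale scale \<beta>"
    and alpha_beta: "\<alpha> (\<beta> a) = \<beta> (\<alpha> a)"
    and alpha_d: "\<alpha> (d a) = d (\<alpha> a)"
    and beta_d: "\<beta> (d a) = d (\<beta> a)"
    and bilinear_br: "bilinear_op scale br"
    and alpha_br: "commutes_with_op \<alpha> br"
    and beta_br: "commutes_with_op \<beta> br"
    and br_d_left: "br (d a) b = - pCons 0 (br a b)"
    and br_d_right: "br a (d b) = map_poly d (br a b) + pCons 0 (br a b)"
    and skew: "br (\<beta> a) (\<alpha> b) = - subst_skew d (br (\<beta> b) (\<alpha> a))"
    and jacobi:
      "subst_poly (\<lambda>w. br_at br mult_lambda (\<alpha> (\<beta> a)) w) mult_mu (br b c) =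
       subst_poly (\<lambda>w. br_at br mult_lambda_mu w (\<beta> c)) mult_lambda (br (\<beta> a) b) +
       subst_poly (\<lambda>w. br_at br mult_mu (\<beta> b) w) mult_lambda (br (\<alpha> a) c)"

locale regular_bihom_lie_conformal_algebra = bihom_lie_conformal_algebra +
  assumes bij_alpha: "bij \<alpha>"
    and bij_beta: "bij \<beta>"

text \<open>
  Only \<open>scale\<close>, \<open>d\<close>, \<open>\<alpha>\<close>, \<open>\<beta>\<close> enter the definition of 1-cochains with values in \<open>R\<^sub>-\<^sub>1\<close>;
  the action of \<open>R\<close> on itself does not.
\<close>

definition cochain1 :: "(complex \<Rightarrow> 'a::ab_group_add \<Rightarrow> 'a) \<Rightarrow> ('a \<Rightarrow> 'a) \<Rightarrow> ('a \<Rightarrow> 'a) \<Rightarrow> ('a \<Rightarrow> 'a)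
    \<Rightarrow> ('a \<Rightarrow> 'a poly) set" where
  "cochain1 scale d \<alpha> \<beta> =
     {\<gamma>. Vector_Spaces.linear scale (\<lambda>c. map_poly (scale c)) \<gamma> \<and>
         (\<forall>a. \<gamma> (d a) = - pCons 0 (\<gamma> a)) \<and>
         (\<forall>a. \<gamma> (\<alpha> a) = map_poly \<alpha> (\<gamma> a)) \<and>
         (\<forall>a. \<gamma> (\<beta> a) = map_poly \<beta> (\<gamma> a))}"

text \<open>The operator \<open>a \<mapsto> \<gamma>\<^bsub>-\<partial>\<^esub>(a)\<close> of a cochain. Not every \<open>\<complex>[\<partial>]\<close>-linear operator commuting with
  \<open>\<alpha>\<close> and \<open>\<beta>\<close> need arise in this way (a cochain vanishes on \<open>\<partial>\<close>-torsion).\<close>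

definition cochain_operator :: "('a::ab_group_add \<Rightarrow> 'a) \<Rightarrow> ('a \<Rightarrow> 'a poly) \<Rightarrow> 'a \<Rightarrow> 'a" where
  "cochain_operator d \<gamma> a = subst_poly (\<lambda>w. w) (\<lambda>w. - d w) (\<gamma> a)"

definition cochain1_operators :: "(complex \<Rightarrow> 'a::ab_group_add \<Rightarrow> 'a) \<Rightarrow> ('a \<Rightarrow> 'a) \<Rightarrow> ('a \<Rightarrow> 'a)
    \<Rightarrow> ('a \<Rightarrow> 'a) \<Rightarrow> ('a \<Rightarrow> 'a) set" where
  "cochain1_operators scale d \<alpha> \<beta> = cochain_operator d ` cochain1 scale d \<alpha> \<beta>"

definition nijenhuis_bracket :: "('a::ab_group_add \<Rightarrow> 'a \<Rightarrow> 'a poly) \<Rightarrow> ('a \<Rightarrow> 'a)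
    \<Rightarrow> 'a \<Rightarrow> 'a \<Rightarrow> 'a poly" where
  "nijenhuis_bracket br f a b = br (f a) b + br a (f b) - map_poly f (br a b)"

definition nijenhuis_operator :: "('a::ab_group_add \<Rightarrow> 'a \<Rightarrow> 'a poly) \<Rightarrow> ('a \<Rightarrow> 'a) \<Rightarrow> bool" where
  "nijenhuis_operator br f \<longleftrightarrow>
     (\<forall>a b. br (f a) (f b) = map_poly f (nijenhuis_bracket br f a b))"

definition deformed_bracket :: "(complex \<Rightarrow> 'a::ab_group_add \<Rightarrow> 'a) \<Rightarrow> ('a \<Rightarrow> 'a \<Rightarrow> 'a poly)
    \<Rightarrow> ('a \<Rightarrow> 'a \<Rightarrow> 'a poly) \<Rightarrow> complex \<Rightarrow> 'a \<Rightarrow> 'a \<Rightarrow> 'a poly" where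
  "deformed_bracket scale br \<psi> t a b = br a b + map_poly (scale t) (\<psi> a b)"

definition generates_deformation :: "(complex \<Rightarrow> 'a::ab_group_add \<Rightarrow> 'a) \<Rightarrow> ('a \<Rightarrow> 'a)
    \<Rightarrow> ('a \<Rightarrow> 'a) \<Rightarrow> ('a \<Rightarrow> 'a) \<Rightarrow> ('a \<Rightarrow> 'a \<Rightarrow> 'a poly) \<Rightarrow> ('a \<Rightarrow> 'a \<Rightarrow> 'a poly) \<Rightarrow> bool" where
  "generates_deformation scale d \<alpha> \<beta> br \<psi> \<longleftrightarrow>
     bilinear_op scale \<psi> \<and> commutes_with_op \<alpha> \<psi> \<and> commutes_with_op \<beta> \<psi> \<and>
     (\<forall>t. bihom_lie_conformal_algebra scale d \<alpha> \<beta> (deformed_bracket scale br \<psi> t))"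

text \<open>The operator \<open>g\<close> is independent of \<open>t\<close>.\<close>

definition trivial_deformation :: "(complex \<Rightarrow> 'a::ab_group_add \<Rightarrow> 'a) \<Rightarrow> ('a \<Rightarrow> 'a)
    \<Rightarrow> ('a \<Rightarrow> 'a) \<Rightarrow> ('a \<Rightarrow> 'a) \<Rightarrow> ('a \<Rightarrow> 'a \<Rightarrow> 'a poly) \<Rightarrow> ('a \<Rightarrow> 'a \<Rightarrow> 'a poly) \<Rightarrow> bool" where
  "trivial_deformation scale d \<alpha> \<beta> br \<psi> \<longleftrightarrow>
     (\<exists>g \<in> cochain1_operators scale d \<alpha> \<beta>. \<forall>t a b.
        let T = (\<lambda>x. x + scale t (g x))
        in map_poly T (deformed_bracket scale br \<psi> t a b) = br (T a) (T b))"

end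

theory Submission
  imports Defs
begin

text \<open>
  By the Nijenhuis identity \<open>T\<^sub>t = id + t f\<close> satisfies \<open>T\<^sub>t [a\<^sub>\<lambda>b]\<^sub>t = [T\<^sub>t a\<^sub>\<lambda>T\<^sub>t b]\<close>, so it maps the
  Jacobiator of \<open>[\<cdot>\<^sub>\<lambda>\<cdot>]\<^sub>t\<close> to a Jacobiator of the original bracket, which is \<open>0\<close>. The operator \<open>T\<^sub>t\<close>
  need not be injective, but the Jacobiator of \<open>[\<cdot>\<^sub>\<lambda>\<cdot>]\<^sub>t\<close> has the form \<open>t J\<^sub>1 + t^2 J\<^sub>2\<close>, and
  \<open>t J\<^sub>1 + t^2 (J\<^sub>2 + f J\<^sub>1) + t^3 f J\<^sub>2 = 0\<close> for all \<open>t\<close> forces \<open>J\<^sub>1 = J\<^sub>2 = 0\<close>.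
\<close>

section \<open>Substituting additive operators for polynomial variables\<close>

lemma additive_map_poly:
  assumes "additive h"
  shows "additive (map_poly h)"
proof -
  interpret additive h by fact
  show ?thesis
    by unfold_locales (simp add: poly_eq_iff coeff_map_poly zero add)
qed

lemma additive_mult_lambda: "additive mult_lambda"
  unfolding mult_lambda_def
  by (rule additive_map_poly) (simp add: additive_def)

lemma additive_mult_mu: "additive mult_mu"
  by (simp add: additive_def mult_mu_def)

lemma additive_mult_lambda_mu: "additive mult_lambda_mu"
  by (simp add: additive_def mult_lambda_mu_def additive.add [OF additive_mult_lambda]
      additive.add [OF additive_mult_mu])

lemma subst_poly_0 [simp]: "subst_poly e X 0 = e 0"
  by (simp add: subst_poly_def)

text \<open>Horner's rule. It replaces the sum up to the degree by a recursion, so that the facts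
  below follow by induction over \<open>pCons\<close>; \<open>e 0 = 0\<close> makes the recursion
  valid at the zero polynomial too.\<close>

lemma subst_poly_pCons:
  fixes X :: "'m::ab_group_add \<Rightarrow> 'm"
  assumes "e 0 = 0" and "additive X"
  shows "subst_poly e X (pCons a p) = e a + X (subst_poly e X p)"
proof -
  interpret X: additive X by fact
  show ?thesis
    by (cases "p = 0")
      (simp_all add: subst_poly_def assms(1) X.zero X.sum sum.atMost_Suc_shift del: sum.atMost_Suc)
qed

lemma additive_subst_poly:
  fixes e :: "'a::ab_group_add \<Rightarrow> 'm::ab_group_add"
  assumes "additive e" and X: "additive X"
  shows "additive (subst_poly e X)"
proof
  interpret e: additive e by fact
  interpret X: additive X by fact
  show "subst_poly e X (p + q) = subst_poly e X p + subst_poly e X q" for p q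
  proof (induction p q rule: poly_induct2)
    case 0
    show ?case by (simp add: e.zero)
  next
    case (pCons a p b q)
    then show ?case by (simp add: subst_poly_pCons e.zero X e.add X.add)
  qed
qed

text \<open>\<open>H\<close> passes through each Horner step because it intertwines \<open>X\<close>
  with \<open>Y\<close>. Together with \<open>subst_poly_map_poly\<close> this carries a map from
  outside a substitution into the polynomial, which is how all naturality statements below
  arise.\<close>

lemma hom_subst_poly:
  fixes e :: "'a::ab_group_add \<Rightarrow> 'm::ab_group_add" and H :: "'m \<Rightarrow> 'n::ab_group_add"
  assumes "e 0 = 0" and "additive X" and "additive Y" and "additive H"
    and "\<And>q. H (X q) = Y (H q)"
  shows "H (subst_poly e X p) = subst_poly (\<lambda>w. H (e w)) Y p"
proof -
  interpret H: additive H by fact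
  show ?thesis
    by (induction p) (simp_all add: subst_poly_pCons assms H.zero H.add)
qed

lemma subst_poly_map_poly:
  fixes e :: "'a::ab_group_add \<Rightarrow> 'm::ab_group_add"
  assumes "e 0 = 0" and "additive X" and "h 0 = 0"
  shows "subst_poly e X (map_poly h p) = subst_poly (\<lambda>w. e (h w)) X p"
  by (induction p) (simp_all add: subst_poly_pCons map_poly_pCons assms)

lemma subst_poly_add_fun:
  fixes e :: "'a::ab_group_add \<Rightarrow> 'm::ab_group_add"
  assumes "e 0 = 0" and "e' 0 = 0" and "additive X"
  shows "subst_poly (\<lambda>w. e w + e' w) X p = subst_poly e X p + subst_poly e' X p"
proof -
  interpret X: additive X by fact
  show ?thesis
    by (induction p) (simp_all add: subst_poly_pCons assms X.add algebra_simps)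
qed

section \<open>Naturality of nested brackets in \<open>R[\<lambda>, \<mu>]\<close>\<close>

abbreviation map_poly2 :: "('a::zero \<Rightarrow> 'b::zero) \<Rightarrow> 'a poly poly \<Rightarrow> 'b poly poly" where
  "map_poly2 h \<equiv> map_poly (map_poly h)"

text \<open>\<open>X\<close> stands for multiplication by one of \<open>\<lambda>\<close>, \<open>\<mu>\<close>, \<open>\<lambda> + \<mu>\<close>.\<close>

definition natural_mult :: "('a::ab_group_add poly poly \<Rightarrow> 'a poly poly) \<Rightarrow> bool" where
  "natural_mult X \<longleftrightarrow> additive X \<and>
     (\<forall>h. additive h \<longrightarrow> (\<forall>q. map_poly2 h (X q) = X (map_poly2 h q)))"

lemma natural_multD:
  assumes "natural_mult X"
  shows "additive X" and "additive h \<Longrightarrow> map_poly2 h (X q) = X (map_poly2 h q)"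
  using assms by (auto simp: natural_mult_def)

lemma natural_mult_lambda: "natural_mult mult_lambda"
  using additive_mult_lambda
  by (auto simp: natural_mult_def mult_lambda_def poly_eq_iff
      coeff_map_poly coeff_pCons additive.zero split: nat.splits)

lemma natural_mult_mu: "natural_mult mult_mu"
  using additive_mult_mu
  by (auto simp: natural_mult_def mult_mu_def poly_eq_iff
      coeff_map_poly coeff_pCons additive.zero split: nat.splits)

lemma natural_mult_lambda_mu: "natural_mult mult_lambda_mu"
  using natural_mult_lambda natural_mult_mu
  by (auto simp: natural_mult_def additive_mult_lambda_mu mult_lambda_mu_def
      additive.add [OF additive_map_poly [OF additive_map_poly]])

definition biadditive :: "('a::ab_group_add \<Rightarrow> 'a \<Rightarrow> 'a poly) \<Rightarrow> bool" where
  "biadditive br \<longleftrightarrow> (\<forall>u. additive (br u)) \<and> (\<forall>v. additive (\<lambda>u. br u v))"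

lemma additive_br_at:
  assumes "biadditive br" and "natural_mult X"
  shows "additive (br_at br X u)"
proof -
  have "additive (\<lambda>w::'a. [:[:w:]:])"
    by (simp add: additive_def)
  then have "additive (subst_poly (\<lambda>w::'a. [:[:w:]:]) X)"
    by (rule additive_subst_poly) (rule natural_multD [OF assms(2)])
  then show ?thesis
    using assms(1) by (simp add: additive_def br_at_def biadditive_def)
qed

lemma br_at_0:
  assumes "biadditive br" and "natural_mult X"
  shows "br_at br X u 0 = 0"
  by (rule additive.zero [OF additive_br_at [OF assms]])

text \<open>The bracket \<open>br'\<close> and its arguments are left free so that one statement
  covers a homomorphism acting on both slots, a scaling acting on one slot, and a bracket whose
  values are composed with \<open>h\<close>.\<close>

lemma br_at_hom:
  assumes "additive h" and "natural_mult X" and "map_poly h (br u v) = br' u' v'"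
  shows "map_poly2 h (br_at br X u v) = br_at br' X u' v'"
proof -
  have "map_poly2 h (br_at br X u v) = subst_poly (\<lambda>w. map_poly2 h [:[:w:]:]) X (br u v)"
    unfolding br_at_def
    by (intro hom_subst_poly)
      (use assms(1,2) natural_multD [OF assms(2)] in \<open>auto intro: additive_map_poly\<close>)
  also have "\<dots> = subst_poly (\<lambda>w. [:[:h w:]:]) X (br u v)"
    by (simp add: map_poly_pCons additive.zero [OF assms(1)])
  also have "\<dots> = br_at br' X u' v'"
    unfolding br_at_def assms(3) [symmetric]
    by (intro subst_poly_map_poly [symmetric])
      (use natural_multD [OF assms(2)] additive.zero [OF assms(1)] in auto)
  finally show ?thesis .
qed

text \<open>The common shape of the three terms of the Jacobi identity: \<open>p\<close> is the
  inner bracket, its variable becomes \<open>Y\<close>, and the outer bracket is taken at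
  \<open>X\<close>. The term whose fixed argument stands on the right is obtained from the flipped
  bracket.\<close>

definition br_subst :: "('a::ab_group_add \<Rightarrow> 'a \<Rightarrow> 'a poly) \<Rightarrow> ('a poly poly \<Rightarrow> 'a poly poly)
    \<Rightarrow> ('a poly poly \<Rightarrow> 'a poly poly) \<Rightarrow> 'a \<Rightarrow> 'a poly \<Rightarrow> 'a poly poly" where
  "br_subst br X Y u p = subst_poly (\<lambda>w. br_at br X u w) Y p"

lemma additive_br_subst:
  assumes "biadditive br" "natural_mult X" "natural_mult Y"
  shows "additive (br_subst br X Y u)"
  unfolding br_subst_def
  by (intro additive_subst_poly additive_br_at assms natural_multD [OF assms(3)])

text \<open>Compatibility is required only for the fixed pair \<open>u\<close>, \<open>u'\<close>:
  taking \<open>u' = h u\<close> gives homomorphisms, taking \<open>u' = u\<close> gives scalings of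
  the inner bracket.\<close>

lemma br_subst_hom:
  assumes h: "additive h" and br: "biadditive br" "biadditive br'"
    and XY: "natural_mult X" "natural_mult Y"
    and hom: "\<And>w. map_poly h (br u w) = br' u' (h w)"
  shows "map_poly2 h (br_subst br X Y u p) = br_subst br' X Y u' (map_poly h p)"
proof -
  have "map_poly2 h (br_subst br X Y u p) = subst_poly (\<lambda>w. map_poly2 h (br_at br X u w)) Y p"
    unfolding br_subst_def
    by (intro hom_subst_poly)
      (use h br XY natural_multD [OF XY(2)] in \<open>auto intro: additive_map_poly br_at_0\<close>)
  also have "\<dots> = subst_poly (\<lambda>w. br_at br' X u' (h w)) Y p"
    by (simp add: br_at_hom [where br = br and br' = br', OF h XY(1) hom])
  also have "\<dots> = br_subst br' X Y u' (map_poly h p)"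
    unfolding br_subst_def
    by (intro subst_poly_map_poly [symmetric])
      (use h br XY natural_multD [OF XY(2)] in \<open>auto intro: br_at_0 additive.zero\<close>)
  finally show ?thesis .
qed

text \<open>Counterpart for the outer bracket: a scalar in front of its values can be pulled out of
  the whole term.\<close>

lemma br_subst_map_poly:
  assumes h: "additive h" and br: "biadditive br"
    and XY: "natural_mult X" "natural_mult Y"
  shows "br_subst (\<lambda>x y. map_poly h (br x y)) X Y u p = map_poly2 h (br_subst br X Y u p)"
proof -
  have "map_poly2 h (br_subst br X Y u p) = subst_poly (\<lambda>w. map_poly2 h (br_at br X u w)) Y p"
    unfolding br_subst_def
    by (intro hom_subst_poly)
      (use h br XY natural_multD [OF XY(2)] in \<open>auto intro: additive_map_poly br_at_0\<close>)
  also have "\<dots> = br_subst (\<lambda>x y. map_poly h (br x y)) X Y u p"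
    unfolding br_subst_def
    by (simp add: br_at_hom [where br = br and br' = "\<lambda>x y. map_poly h (br x y)", OF h XY(1) refl])
  finally show ?thesis ..
qed

lemma br_subst_add_bracket:
  assumes br: "biadditive br" "biadditive br'"
    and XY: "natural_mult X" "natural_mult Y"
  shows "br_subst (\<lambda>x y. br x y + br' x y) X Y u p = br_subst br X Y u p + br_subst br' X Y u p"
proof -
  have "additive (subst_poly (\<lambda>w::'a. [:[:w:]:]) X)"
    by (rule additive_subst_poly) (simp_all add: additive_def natural_multD [OF XY(1), unfolded additive_def])
  then have "br_at (\<lambda>x y. br x y + br' x y) X u = (\<lambda>w. br_at br X u w + br_at br' X u w)"
    by (simp add: br_at_def additive_def fun_eq_iff)
  then show ?thesis
    by (simp add: br_subst_def subst_poly_add_fun br_at_0 br XY natural_multD [OF XY(2)])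
qed

section \<open>The Jacobiator of a deformed bracket\<close>

lemma biadditive_flip: "biadditive br \<Longrightarrow> biadditive (\<lambda>x y. br y x)"
  by (simp add: biadditive_def)

lemma biadditive_map_poly:
  "additive h \<Longrightarrow> biadditive br \<Longrightarrow> biadditive (\<lambda>x y. map_poly h (br x y))"
  using additive_map_poly [of h] by (simp add: biadditive_def additive_def)

text \<open>The parameter enters once through the outer and once through the inner bracket, so with
  \<open>h = scale t\<close> the term is quadratic in \<open>t\<close>; the summands are grouped by
  powers of \<open>h\<close>.\<close>

lemma br_subst_deformed:
  assumes h: "additive h" and br: "biadditive br" "biadditive \<psi>"
    and XY: "natural_mult X" "natural_mult Y"
    and hom: "\<And>u v. map_poly h (br u v) = br u (h v)" "\<And>u v. map_poly h (\<psi> u v) = \<psi> u (h v)"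
  shows "br_subst (\<lambda>x y. br x y + map_poly h (\<psi> x y)) X Y u (p + map_poly h q) =
    br_subst br X Y u p + map_poly2 h (br_subst br X Y u q + br_subst \<psi> X Y u p)
      + map_poly2 h (map_poly2 h (br_subst \<psi> X Y u q))"
proof -
  note add = additive.add [OF additive_br_subst [OF _ XY]]
  have h2: "additive (map_poly2 h)"
    by (intro additive_map_poly h)
  show ?thesis
    by (simp add: br_subst_add_bracket br_subst_map_poly biadditive_map_poly h br XY add
        br_subst_hom [where br = br and br' = br, OF h br(1) br(1) XY hom(1)]
        br_subst_hom [where br = \<psi> and br' = \<psi>, OF h br(2) br(2) XY hom(2)]
        additive.add [OF h2] algebra_simps)
qed

text \<open>The two brackets, the outer one \<open>br\<close> and the inner one \<open>br'\<close>, are kept apart so that the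
  expression is bilinear in them.\<close>

definition jacobiator :: "('a::ab_group_add \<Rightarrow> 'a) \<Rightarrow> ('a \<Rightarrow> 'a) \<Rightarrow> ('a \<Rightarrow> 'a \<Rightarrow> 'a poly)
    \<Rightarrow> ('a \<Rightarrow> 'a \<Rightarrow> 'a poly) \<Rightarrow> 'a \<Rightarrow> 'a \<Rightarrow> 'a \<Rightarrow> 'a poly poly" where
  "jacobiator \<alpha> \<beta> br br' a b c =
     br_subst br mult_lambda mult_mu (\<alpha> (\<beta> a)) (br' b c)
     - br_subst (\<lambda>x y. br y x) mult_lambda_mu mult_lambda (\<beta> c) (br' (\<beta> a) b)
     - br_subst br mult_mu mult_lambda (\<beta> b) (br' (\<alpha> a) c)"

lemma jacobiator_eq_0_iff:
  "jacobiator \<alpha> \<beta> br br a b c = 0 \<longleftrightarrow>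
      subst_poly (\<lambda>w. br_at br mult_lambda (\<alpha> (\<beta> a)) w) mult_mu (br b c) =
       subst_poly (\<lambda>w. br_at br mult_lambda_mu w (\<beta> c)) mult_lambda (br (\<beta> a) b) +
       subst_poly (\<lambda>w. br_at br mult_mu (\<beta> b) w) mult_lambda (br (\<alpha> a) c)"
  by (simp add: jacobiator_def br_subst_def br_at_def algebra_simps)

text \<open>A morphism from \<open>br\<close> to \<open>br'\<close> commuting with \<alpha> and
  \<beta> acts on each of the three terms separately. Bijectivity plays no part in this, so it
  applies to \<open>T t\<close> for every \<open>t\<close>.\<close>

lemma jacobiator_hom:
  assumes h: "additive h" and br: "biadditive br" "biadditive br'"
    and hom: "\<And>x y. map_poly h (br x y) = br' (h x) (h y)"
    and comm: "\<And>x. h (\<alpha> x) = \<alpha> (h x)" "\<And>x. h (\<beta> x) = \<beta> (h x)"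
  shows "map_poly2 h (jacobiator \<alpha> \<beta> br br a b c) = jacobiator \<alpha> \<beta> br' br' (h a) (h b) (h c)"
proof -
  have h2: "additive (map_poly2 h)"
    by (intro additive_map_poly h)
  have "map_poly2 h (br_subst br X Y u (br x y)) = br_subst br' X Y (h u) (br' (h x) (h y))"
    "map_poly2 h (br_subst (\<lambda>x y. br y x) X Y u (br x y)) =
      br_subst (\<lambda>x y. br' y x) X Y (h u) (br' (h x) (h y))"
    if "natural_mult X" "natural_mult Y" for X Y u x y
    using br_subst_hom [where br = br and br' = br', OF h br that hom]
      br_subst_hom [where br = "\<lambda>x y. br y x" and br' = "\<lambda>x y. br' y x",
        OF h br [THEN biadditive_flip] that hom] by (simp_all add: hom)
  then show ?thesis
    by (simp add: jacobiator_def additive.diff [OF h2] natural_mult_lambda natural_mult_mu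
        natural_mult_lambda_mu comm)
qed

text \<open>For \<open>h = scale t\<close> these are the coefficients of 1, t and t^2. The linear
  coefficient collects the two mixed terms, with \<open>\<psi>\<close> as the inner and as the outer
  bracket.\<close>

lemma jacobiator_deformed:
  assumes h: "additive h" and br: "biadditive br" "biadditive \<psi>"
    and hom: "\<And>u v. map_poly h (br u v) = br u (h v)" "\<And>u v. map_poly h (\<psi> u v) = \<psi> u (h v)"
      "\<And>u v. map_poly h (br u v) = br (h u) v" "\<And>u v. map_poly h (\<psi> u v) = \<psi> (h u) v"
  defines "D \<equiv> \<lambda>x y. br x y + map_poly h (\<psi> x y)"
  shows "jacobiator \<alpha> \<beta> D D a b c = jacobiator \<alpha> \<beta> br br a b c
    + map_poly2 h (jacobiator \<alpha> \<beta> br \<psi> a b c + jacobiator \<alpha> \<beta> \<psi> br a b c)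
    + map_poly2 h (map_poly2 h (jacobiator \<alpha> \<beta> \<psi> \<psi> a b c))"
proof -
  have h2: "additive (map_poly2 h)"
    by (intro additive_map_poly h)
  note R = br_subst_deformed [where br = br and \<psi> = \<psi>, OF h br _ _ hom(1,2)]
  note L = br_subst_deformed [where br = "\<lambda>x y. br y x" and \<psi> = "\<lambda>x y. \<psi> y x",
      OF h br [THEN biadditive_flip] _ _ hom(3,4)]
  show ?thesis
    unfolding jacobiator_def D_def
    by (simp add: R L natural_mult_lambda natural_mult_mu natural_mult_lambda_mu
        additive.diff [OF h2] additive.add [OF h2])
qed

text \<open>The values at t = 1, -1 and 2 already isolate \<open>x\<close> and \<open>y\<close>, by
  linear combinations that require dividing only by 2 and 6.\<close>

lemma (in vector_space) cubic_vanishing: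
  assumes P: "\<And>t. scale t x + scale (t ^ 2) y + scale (t ^ 3) z = 0"
    and "(2::'a) \<noteq> 0" and "(6::'a) \<noteq> 0"
  shows "x = 0" and "y = 0"
proof -
  let ?P = "\<lambda>t. scale t x + scale (t ^ 2) y + scale (t ^ 3) z"
  \<comment> \<open>The odd terms cancel.\<close>
  have "scale 2 y = ?P 1 + ?P (- 1)"
    using scale_left_distrib [of 1 1 y] by simp
  then have "scale 2 y = 0" by (simp only: P) simp
  then show "y = 0" using assms(2) by simp
  have e: "scale 6 w = scale 4 w + scale 2 w" "scale 8 w = scale 4 w + scale 2 w + scale 2 w" for w
    by (simp_all flip: scale_left_distrib)
  \<comment> \<open>The weights 6, -2, -1 cancel \<open>y\<close> (6 - 2 - 4) and \<open>z\<close>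
    (6 + 2 - 8) and leave 6 + 2 - 2 = 6 copies of \<open>x\<close>. The splittings \<open>e\<close>
    reduce this to cancellation in an abelian group.\<close>
  have "scale 6 x = scale 6 (?P 1) - scale 2 (?P (- 1)) - ?P 2"
    by (simp add: e scale_right_distrib scale_right_diff_distrib)
  then have "scale 6 x = 0" by (simp only: P) simp
  then show "x = 0" using assms(3) by simp
qed

section \<open>The substitution of -\<lambda>-\<partial>\<close>

lemma additive_linear:
  "Vector_Spaces.linear s1 s2 h \<Longrightarrow> additive h"
  by (simp add: additive_def Vector_Spaces.linear_iff)

lemma additive_skew_arg:
  assumes "additive d"
  shows "additive (\<lambda>q. - pCons 0 q - map_poly d q)"
  using additive.add [OF additive_map_poly [OF assms]] by (simp add: additive_def)

lemma additive_subst_skew: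
  assumes "additive d"
  shows "additive (subst_skew d)"
proof -
  have "additive (\<lambda>w::'a. [:w:])"
    by (simp add: additive_def)
  then have "additive (subst_poly (\<lambda>w::'a. [:w:]) (\<lambda>q. - pCons 0 q - map_poly d q))"
    by (rule additive_subst_poly) (rule additive_skew_arg [OF assms])
  then show ?thesis
    by (simp add: additive_def subst_skew_def)
qed

lemma map_poly_commute:
  assumes "g 0 = 0" "h 0 = 0" "\<And>x. g (h x) = h (g x)"
  shows "map_poly g (map_poly h p) = map_poly h (map_poly g p)"
  by (simp add: poly_eq_iff coeff_map_poly assms)

text \<open>A map commuting with \<partial> also commutes with the operator -\<lambda>-\<partial> on
  \<open>R[\<lambda>]\<close>. Used for \<open>f\<close> and for scalars.\<close>

lemma map_poly_subst_skew:
  assumes h: "additive h" and d: "additive d" and comm: "\<And>x. h (d x) = d (h x)"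
  shows "map_poly h (subst_skew d p) = subst_skew d (map_poly h p)"
proof -
  note [simp] = additive.zero [OF h] additive.zero [OF d]
  have "map_poly h (subst_skew d p) =
      subst_poly (\<lambda>w. map_poly h [:w:]) (\<lambda>q. - pCons 0 q - map_poly d q) p"
    unfolding subst_skew_def
    by (intro hom_subst_poly additive_skew_arg additive_map_poly h d)
      (simp_all add: additive.diff [OF additive_map_poly [OF h]] map_poly_pCons
        additive.minus [OF additive_map_poly [OF h]] map_poly_commute [of h d] comm)
  also have "\<dots> = subst_skew d (map_poly h p)"
    unfolding subst_skew_def
    by (subst subst_poly_map_poly) (simp_all add: map_poly_pCons additive_skew_arg [OF d, simplified])
  finally show ?thesis .
qed

section \<open>Cochain operators and bilinearity\<close>

context bihom_lie_conformal_algebra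
begin

lemma cochain_operator_props:
  assumes "f \<in> cochain1_operators scale d \<alpha> \<beta>"
  shows "Vector_Spaces.linear scale scale f"
    and "f (d a) = d (f a)" and "f (\<alpha> a) = \<alpha> (f a)" and "f (\<beta> a) = \<beta> (f a)"
proof -
  from assms obtain \<gamma> where f: "f = cochain_operator d \<gamma>"
    and \<gamma>: "Vector_Spaces.linear scale (\<lambda>c. map_poly (scale c)) \<gamma>"
      "\<And>a. \<gamma> (d a) = - pCons 0 (\<gamma> a)" "\<And>a. \<gamma> (\<alpha> a) = map_poly \<alpha> (\<gamma> a)"
      "\<And>a. \<gamma> (\<beta> a) = map_poly \<beta> (\<gamma> a)"
    by (auto simp: cochain1_operators_def cochain1_def)
  let ?S = "subst_poly (\<lambda>w. w) (\<lambda>w. - d w)"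
  have f': "f a = ?S (\<gamma> a)" for a
    by (simp add: f cochain_operator_def)
  have X: "additive (\<lambda>w. - d w)"
    using additive_linear [OF linear_d] by (simp add: additive_def)
  have S: "additive ?S"
    by (intro additive_subst_poly X) (simp add: additive_def)
  \<comment> \<open>Evaluation at -\<partial> commutes with every additive map that commutes with
    \<partial>: here \<alpha>, \<beta> and the scalars.\<close>
  have comm: "h (?S p) = ?S (map_poly h p)" if "additive h" "\<And>x. h (d x) = d (h x)" for h p
  proof -
    have "h (?S p) = subst_poly (\<lambda>w. h w) (\<lambda>w. - d w) p"
      by (rule hom_subst_poly) (simp_all add: X that additive.minus [OF that(1)])
    also have "\<dots> = ?S (map_poly h p)"
      by (rule subst_poly_map_poly [symmetric]) (simp_all add: X additive.zero [OF that(1)])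
    finally show ?thesis .
  qed
  show "f (\<alpha> a) = \<alpha> (f a)"
    by (simp add: f' \<gamma> comm additive_linear [OF linear_alpha] alpha_d)
  show "f (\<beta> a) = \<beta> (f a)"
    by (simp add: f' \<gamma> comm additive_linear [OF linear_beta] beta_d)
  \<comment> \<open>At \<lambda> = -\<partial> the factor -\<lambda> in
    \<open>\<gamma> (d a)\<close> becomes \<partial>.\<close>
  show "f (d a) = d (f a)"
    by (simp add: f' \<gamma> additive.minus [OF S] subst_poly_pCons X additive.minus [OF additive_linear [OF linear_d]])
  have "additive (scale c)" "scale c (d x) = d (scale c x)" for c x
    using linear_d by (simp_all add: additive_def Vector_Spaces.linear_iff scale_right_distrib)
  then show "Vector_Spaces.linear scale scale f"
    using \<gamma>(1) by (simp add: Vector_Spaces.linear_iff f' additive.add [OF S] comm)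
qed

lemma additive_scale: "additive (scale c)"
  by (simp add: additive_def scale_right_distrib)

lemma biadditive_br: "biadditive br"
  using bilinear_br by (auto simp: biadditive_def bilinear_op_def intro: additive_linear)

text \<open>\<open>Vector_Spaces.linear\<close> includes the vector space laws of its target, so
  they can be read off from the bilinearity of \<open>br\<close>.\<close>

lemma vector_space_poly: "vector_space (\<lambda>c. map_poly (scale c))"
  using bilinear_br by (simp add: bilinear_op_def Vector_Spaces.linear_iff)

lemma bilinear_op_iff:
  "bilinear_op scale b \<longleftrightarrow> biadditive b \<and>
    (\<forall>c x y. b (scale c x) y = map_poly (scale c) (b x y)) \<and>
    (\<forall>c x y. b x (scale c y) = map_poly (scale c) (b x y))"
  using vector_space_poly vector_space_axioms
  by (auto simp: bilinear_op_def biadditive_def Vector_Spaces.linear_iff additive_def)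

lemma br_scale: "br (scale c x) y = map_poly (scale c) (br x y)"
    "br x (scale c y) = map_poly (scale c) (br x y)"
  using bilinear_br by (simp_all add: bilinear_op_iff)

end

section \<open>The deformation given by a Nijenhuis operator\<close>

locale nijenhuis = bihom_lie_conformal_algebra +
  fixes f
  assumes linear_f: "Vector_Spaces.linear scale scale f"
    and f_d: "f (d a) = d (f a)" and f_alpha: "f (\<alpha> a) = \<alpha> (f a)" and f_beta: "f (\<beta> a) = \<beta> (f a)"
    and nijenhuis: "nijenhuis_operator br f"
begin

abbreviation \<psi> where "\<psi> \<equiv> nijenhuis_bracket br f"

abbreviation D where "D t \<equiv> deformed_bracket scale br \<psi> t"

abbreviation T where "T t x \<equiv> x + scale t (f x)"

lemma additive_f: "additive f"
  by (rule additive_linear [OF linear_f])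

lemma f_scale: "f (scale c x) = scale c (f x)"
  using linear_f by (simp add: Vector_Spaces.linear_iff)

lemmas br_add = additive.add [OF biadditive_br [unfolded biadditive_def, THEN conjunct1, rule_format]]
  additive.add [OF biadditive_br [unfolded biadditive_def, THEN conjunct2, rule_format]]

lemmas map_poly_additive_add = additive.add [OF additive_map_poly [OF additive_f]]
  additive.add [OF additive_map_poly [OF additive_scale]]

lemmas map_poly_additive_diff = additive.diff [OF additive_map_poly [OF additive_f]]
  additive.diff [OF additive_map_poly [OF additive_scale]]

lemma map_poly_f_scale: "map_poly f (map_poly (scale c) p) = map_poly (scale c) (map_poly f p)"
  by (rule map_poly_commute) (simp_all add: additive.zero [OF additive_f] f_scale)

lemma bilinear_psi: "bilinear_op scale \<psi>"
  by (auto simp: bilinear_op_iff nijenhuis_bracket_def biadditive_def additive_def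
      additive.add [OF additive_f] br_add map_poly_additive_add map_poly_additive_diff f_scale br_scale map_poly_f_scale)

lemma commutes_psi:
  assumes h: "additive h" and f: "\<And>x. f (h x) = h (f x)" and br: "commutes_with_op h br"
  shows "commutes_with_op h \<psi>"
proof -
  note H = additive_map_poly [OF h]
  have "map_poly h (map_poly f p) = map_poly f (map_poly h p)" for p
    by (rule map_poly_commute) (simp_all add: additive.zero [OF h] additive.zero [OF additive_f] f)
  then show ?thesis
    using br
    by (simp add: commutes_with_op_def nijenhuis_bracket_def f additive.add [OF H] additive.diff [OF H])
qed

text \<open>Compare powers of t. The linear terms agree by the definition of \<open>\<psi>\<close>,
  the quadratic ones by the Nijenhuis identity.\<close>

lemma T_deformed: "map_poly (T t) (D t a b) = br (T t a) (T t b)"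
proof -
  have T: "map_poly (T t) p = p + map_poly (scale t) (map_poly f p)" for p
    by (simp add: poly_eq_iff coeff_map_poly additive.zero [OF additive_f])
  have N: "br (f a) (f b) = map_poly f (\<psi> a b)"
    using nijenhuis by (simp add: nijenhuis_operator_def)
  \<comment> \<open>The summand \<open>- f [a b]\<close> of \<open>\<psi>\<close> cancels against
    the linear part of \<open>T t\<close> applied to \<open>br a b\<close>.\<close>
  have "D t a b + map_poly (scale t) (map_poly f (br a b)) =
    br a b + map_poly (scale t) (br (f a) b + br a (f b))"
    by (simp add: deformed_bracket_def nijenhuis_bracket_def map_poly_additive_add map_poly_additive_diff)
  then show ?thesis
    by (simp add: T N br_add br_scale deformed_bracket_def map_poly_additive_add map_poly_f_scale algebra_simps)
qed

lemma D_eq: "D t = (\<lambda>x y. br x y + map_poly (scale t) (\<psi> x y))"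
  by (simp add: fun_eq_iff deformed_bracket_def)

lemma biadditive_psi: "biadditive \<psi>"
  and psi_scale: "\<psi> (scale c x) y = map_poly (scale c) (\<psi> x y)"
    "\<psi> x (scale c y) = map_poly (scale c) (\<psi> x y)"
  using bilinear_psi by (simp_all add: bilinear_op_iff)

lemma bilinear_D: "bilinear_op scale (D t)"
proof -
  have "map_poly (scale t) (map_poly (scale c) p) = map_poly (scale c) (map_poly (scale t) p)" for c p
    by (rule map_poly_commute) (simp_all add: scale_left_commute)
  moreover note biadditive_psi
  ultimately show ?thesis
    by (auto simp: bilinear_op_iff D_eq biadditive_def additive_def br_add map_poly_additive_add br_scale psi_scale)
qed

lemma jacobiator_D: "jacobiator \<alpha> \<beta> (D t) (D t) a b c = 0"
proof -
  define J1 where "J1 = jacobiator \<alpha> \<beta> br \<psi> a b c + jacobiator \<alpha> \<beta> \<psi> br a b c"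
  define J2 where "J2 = jacobiator \<alpha> \<beta> \<psi> \<psi> a b c"
  have J0: "jacobiator \<alpha> \<beta> br br a b c = 0" for a b c
    unfolding jacobiator_eq_0_iff by (rule jacobi)
  have J: "jacobiator \<alpha> \<beta> (D s) (D s) a b c =
      map_poly2 (scale s) J1 + map_poly2 (scale s) (map_poly2 (scale s) J2)" for s
    unfolding D_eq J1_def J2_def
    by (subst jacobiator_deformed)
      (simp_all add: additive_scale biadditive_br biadditive_psi br_scale psi_scale J0)
  have T: "additive (T s)" for s
    by (simp add: additive_def additive.add [OF additive_f] scale_right_distrib)
  \<comment> \<open>The goal concerns one value \<open>t\<close>, but the argument needs this for
    all values \<open>s\<close>, since coefficients in \<open>s\<close> are compared.\<close>
  have "map_poly2 (T s) (jacobiator \<alpha> \<beta> (D s) (D s) a b c) = 0" for s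
  proof -
    have "map_poly2 (T s) (jacobiator \<alpha> \<beta> (D s) (D s) a b c) =
        jacobiator \<alpha> \<beta> br br (T s a) (T s b) (T s c)"
      using bilinear_D [of s] linear_alpha linear_beta
      by (intro jacobiator_hom [OF T _ biadditive_br T_deformed])
        (simp_all add: bilinear_op_iff Vector_Spaces.linear_iff f_alpha f_beta)
    then show ?thesis by (simp add: J0)
  qed
  \<comment> \<open>Passing to coefficients gives an identity between vectors of \<open>R\<close>,
    to which \<open>cubic_vanishing\<close> applies.\<close>
  then have TJ: "T s (scale s (coeff (coeff J1 i) j) + scale s (scale s (coeff (coeff J2 i) j))) = 0"
    for s i j
    by (simp add: J poly_eq_iff coeff_map_poly additive.zero [OF additive_f])
  have "coeff (coeff J1 i) j = 0 \<and> coeff (coeff J2 i) j = 0" for i j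
  proof -
    let ?x = "coeff (coeff J1 i) j" and ?y = "coeff (coeff J2 i) j"
    have "scale s ?x + scale (s ^ 2) (?y + f ?x) + scale (s ^ 3) (f ?y) = 0" for s
      using TJ [of s i j]
      by (simp add: f_scale additive.add [OF additive_f] scale_right_distrib power2_eq_square
          power3_eq_cube algebra_simps)
    \<comment> \<open>First \<open>?x = 0\<close>; then \<open>?y + f ?x = 0\<close> becomes
      \<open>?y = 0\<close>.\<close>
    note this [THEN cubic_vanishing(1)] this [THEN cubic_vanishing(2)]
    then show ?thesis by (simp add: additive.zero [OF additive_f])
  qed
  then have "J1 = 0" "J2 = 0"
    by (simp_all add: poly_eq_iff)
  then show ?thesis
    by (simp add: J)
qed

section \<open>The remaining axioms for the deformed bracket\<close>

lemma psi_d_left: "\<psi> (d a) b = - pCons 0 (\<psi> a b)"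
  by (simp add: nijenhuis_bracket_def f_d br_d_left map_poly_pCons additive.zero [OF additive_f]
      additive.minus [OF additive_map_poly [OF additive_f]])

lemma psi_d_right: "\<psi> a (d b) = map_poly d (\<psi> a b) + pCons 0 (\<psi> a b)"
proof -
  note d = additive_linear [OF linear_d]
  show ?thesis
    by (simp add: nijenhuis_bracket_def f_d br_d_right map_poly_pCons additive.zero [OF additive_f]
        map_poly_additive_add additive.add [OF additive_map_poly [OF d]] additive.diff [OF additive_map_poly [OF d]]
        map_poly_commute [where g = f and h = d, OF additive.zero [OF additive_f] additive.zero [OF d] f_d])
qed

lemma psi_skew: "\<psi> (\<beta> a) (\<alpha> b) = - subst_skew d (\<psi> (\<beta> b) (\<alpha> a))"
proof -
  note d = additive_linear [OF linear_d]
  note S = additive_subst_skew [OF d]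
  show ?thesis
    \<comment> \<open>Skew-symmetry exchanges the first two summands of \<open>\<psi>\<close> and
      preserves the third. It is instantiated at \<open>a\<close> and \<open>f a\<close> because as
      a general rewrite rule it would loop.\<close>
    by (simp add: nijenhuis_bracket_def f_alpha f_beta skew [of a] skew [of "f a"]
        additive.add [OF S] additive.diff [OF S] map_poly_subst_skew [OF additive_f d f_d, symmetric]
        additive.minus [OF additive_map_poly [OF additive_f]])
qed

lemma bihom_lie_conformal_algebra_D: "bihom_lie_conformal_algebra scale d \<alpha> \<beta> (D t)"
proof (intro bihom_lie_conformal_algebra.intro bihom_lie_conformal_algebra_axioms.intro)
  note d = additive_linear [OF linear_d]
  note S = additive_subst_skew [OF d]
  have d_scale: "d (scale c x) = scale c (d x)" for c x
    using linear_d by (simp add: Vector_Spaces.linear_iff)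
  have comm: "commutes_with_op h (D t)"
    if h: "Vector_Spaces.linear scale scale h" and f: "\<And>x. f (h x) = h (f x)"
      and br: "commutes_with_op h br" for h
  proof -
    note h' = additive_linear [OF h]
    have "map_poly h (map_poly (scale t) p) = map_poly (scale t) (map_poly h p)" for p
      using h by (intro map_poly_commute) (simp_all add: additive.zero [OF h'] Vector_Spaces.linear_iff)
    then show ?thesis
      using br commutes_psi [OF h' f br]
      by (simp add: commutes_with_op_def D_eq additive.add [OF additive_map_poly [OF h']])
  qed
  show "commutes_with_op \<alpha> (D t)"
    by (rule comm [OF linear_alpha f_alpha alpha_br])
  show "commutes_with_op \<beta> (D t)"
    by (rule comm [OF linear_beta f_beta beta_br])
  show "D t (d a) b = - pCons 0 (D t a b)" for a b
    by (simp add: D_eq br_d_left psi_d_left map_poly_pCons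
        additive.minus [OF additive_map_poly [OF additive_scale]])
  show "D t a (d b) = map_poly d (D t a b) + pCons 0 (D t a b)" for a b
    by (simp add: D_eq br_d_right psi_d_right map_poly_pCons map_poly_additive_add
        additive.add [OF additive_map_poly [OF d]]
        map_poly_commute [where g = d and h = "scale t", OF additive.zero [OF d] additive.zero [OF additive_scale] d_scale])
  show "D t (\<beta> a) (\<alpha> b) = - subst_skew d (D t (\<beta> b) (\<alpha> a))" for a b
    by (simp add: D_eq skew [of a] psi_skew [of a] additive.add [OF S]
        map_poly_subst_skew [where h = "scale t" and d = d, OF additive_scale d d_scale [symmetric]]
        additive.minus [OF additive_map_poly [OF additive_scale]])
qed (use vector_space_axioms linear_d linear_alpha linear_beta bilinear_D jacobiator_D [unfolded jacobiator_eq_0_iff]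
    in \<open>simp_all add: alpha_beta alpha_d beta_d\<close>)

end

theorem theorem3p2:
  fixes scale :: "complex \<Rightarrow> 'a::ab_group_add \<Rightarrow> 'a"
    and d \<alpha> \<beta> f :: "'a \<Rightarrow> 'a"
    and br :: "'a \<Rightarrow> 'a \<Rightarrow> 'a poly"
  assumes "regular_bihom_lie_conformal_algebra scale d \<alpha> \<beta> br"
    and "f \<in> cochain1_operators scale d \<alpha> \<beta>"
    and "nijenhuis_operator br f"
  shows "generates_deformation scale d \<alpha> \<beta> br (nijenhuis_bracket br f) \<and>
         trivial_deformation scale d \<alpha> \<beta> br (nijenhuis_bracket br f)"
proof -
  interpret bihom_lie_conformal_algebra scale d \<alpha> \<beta> br
    using assms(1) by (rule regular_bihom_lie_conformal_algebra.axioms(1))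
  interpret nijenhuis scale d \<alpha> \<beta> br f
    by (intro nijenhuis.intro nijenhuis_axioms.intro bihom_lie_conformal_algebra_axioms assms(3)
        cochain_operator_props [OF assms(2)])
  have "generates_deformation scale d \<alpha> \<beta> br \<psi>"
    using commutes_psi [OF additive_linear [OF linear_alpha] f_alpha alpha_br]
      commutes_psi [OF additive_linear [OF linear_beta] f_beta beta_br]
    by (simp add: generates_deformation_def bilinear_psi bihom_lie_conformal_algebra_D)
  moreover have "trivial_deformation scale d \<alpha> \<beta> br \<psi>"
    unfolding trivial_deformation_def Let_def
    \<comment> \<open>The witness is \<open>g = f\<close>, the same for all t.\<close>
    by (intro bexI [OF _ assms(2)] allI T_deformed)
  ultimately show ?thesis by blast
qed

end
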